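(* Optimal behavior in ski rental with known varying prices $p$ is as follows. (a) If day $M_*(p)+1$ is a free day or day $M_*(p)$ is a bargain day, let $d$ be the first such day (i.e. $d=M_*(p)$ if day $M_*(p)$ is a bargain day, and $d=M_*(p)+1$ otherwise). Then the algorithm that waits for day $d$, renting until then and acquiring the resource on day $d$ (at price $p_d$), is $1$-competitive. The only other $1$-competitive algorithm exists when the first bargain day $b=M_*(p)$ is followed by the first free day $f=M_*(p)+1$; this algorithm rents on all days before $f$, waiting for day $f$. (b) Suppose case (a) does not apply, i.e. $1<p_i\le B$ for $1\le i\le M_*(p)$ and $p_{M_*(p)+1}\ge 1$. Then no deterministic algorithm can be better than $c_{OPT}(p)$-competitive, where $$c_{OPT}(p):=\min\Bigl(\Bigl\{\tfrac{P_r}{r}:r\le M_*(p)\Bigr\}\cup\Bigl\{\tfrac{Q_{M_*(p)}}{M_*(p)}\Bigr\}\Bigr).$$ The algorithms that buy on a day $r$ attaining the minimum in $$\Bigl\{\tfrac{P_r}{OPT_r}:1\le r\le M_*(p)\Bigr\}\cup\Bigl\{\tfrac{P_r}{M_*(p)}: r\ge M_*(p),\ P_r=Q_{M_*(p)}\Bigr\}$$ are the only ones to achieve this ratio.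
   Context: Fix an integer $B\ge2$. A price sequence $p=(p_i)_{i\ge1}$ consists of integers $0\le p_i\le B$ and is truncated at the first $i$ with $p_i=0$; so $p$ is either infinite with all entries $\ge1$, or finite, $p=(p_1,\dots,p_n)$ with $p_n=0$ and $p_i\ge 1$ for $i<n$. All quantities below range only over indices $i$ for which $p_i$ is defined. Day $i$ is a free day if $p_i=0$ and a bargain day if $p_i=1$. Put $P_i=i-1+p_i$ (total cost of buying exactly on day $i$ after renting on the previous days), $M_*(p)=\min\{P_i:i\ge1\}$ and $Q_t=\min\{P_i:i\ge t\}$. The agent knows $p$ but not the number $T\ge1$ of days it will be active. Renting costs $1$ per day. A deterministic algorithm is specified by a buying day $r$ (an index of $p$) or by $r=\infty$ (always rent): it rents on days before $r$ and buys on day $r$. Its cost for active time $T$ is $T$ if $T<r$ and $P_r$ if $T\ge r$. The offline optimum for active time $T$ is $OPT_T=\min\bigl(\{T\}\cup\{P_i:1\le i\le T\}\bigr)$. For given $p$ the inputs are the values of $T$. An algorithm is $\gamma$-competitive if there exists a constant $d_0$ (which may depend on $\gamma$, but not on the input) such that its cost is at most $\gamma\cdot OPT_T+d_0$ for all $T\ge1$; it achieves the ratio $\gamma$ if it is $\gamma$-competitive.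
   Formalization: Competitiveness is taken with additive constant d_0 = 0: if d_0 > 0 independent of T were allowed, any algorithm that buys on a finite day would be γ-competitive for every γ ≥ 0, so the lower bound and the "only" claims would fail. *)

theory Defs
  imports Complex_Main "HOL-Library.Extended_Nat"
begin

text \<open>A price sequence is a function on \<open>nat\<close>, indexed from \<open>1\<close>, of which only the part up to and
  including the first zero is meaningful. \<open>days p\<close> is the set of indices at which the truncated
  sequence is defined; every notion below looks at \<open>p\<close> on \<open>days p\<close> only.\<close>

definition days :: "(nat \<Rightarrow> nat) \<Rightarrow> nat set" where
  "days p = {i. 1 \<le> i \<and> (\<forall>j. 1 \<le> j \<and> j < i \<longrightarrow> p j \<noteq> 0)}"

definition price_sequence :: "nat \<Rightarrow> (nat \<Rightarrow> nat) \<Rightarrow> bool" where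
  "price_sequence B p \<longleftrightarrow> (\<forall>i\<in>days p. p i \<le> B)"

definition free_day :: "(nat \<Rightarrow> nat) \<Rightarrow> nat \<Rightarrow> bool" where
  "free_day p i \<longleftrightarrow> i \<in> days p \<and> p i = 0"

definition bargain_day :: "(nat \<Rightarrow> nat) \<Rightarrow> nat \<Rightarrow> bool" where
  "bargain_day p i \<longleftrightarrow> i \<in> days p \<and> p i = 1"

definition first_free_day :: "(nat \<Rightarrow> nat) \<Rightarrow> nat \<Rightarrow> bool" where
  "first_free_day p f \<longleftrightarrow> free_day p f \<and> (\<forall>i<f. \<not> free_day p i)"

definition first_bargain_day :: "(nat \<Rightarrow> nat) \<Rightarrow> nat \<Rightarrow> bool" where
  "first_bargain_day p b \<longleftrightarrow> bargain_day p b \<and> (\<forall>i<b. \<not> bargain_day p i)"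

definition buy_cost :: "(nat \<Rightarrow> nat) \<Rightarrow> nat \<Rightarrow> nat" where
  "buy_cost p i = i - 1 + p i"

text \<open>The sets below may be infinite, so \<open>Min\<close> is not available; on a nonempty set of natural
  numbers \<open>Inf\<close> is the minimum. The set for \<open>M_star\<close> is never empty, since \<open>1 \<in> days p\<close>.\<close>

definition M_star :: "(nat \<Rightarrow> nat) \<Rightarrow> nat" where
  "M_star p = Inf {buy_cost p i |i. i \<in> days p}"

definition Q :: "(nat \<Rightarrow> nat) \<Rightarrow> nat \<Rightarrow> nat" where
  "Q p t = Inf {buy_cost p i |i. i \<in> days p \<and> t \<le> i}"

text \<open>A deterministic algorithm is its buying day; \<open>\<infinity>\<close> means that it always rents.\<close>

definition algorithms :: "(nat \<Rightarrow> nat) \<Rightarrow> enat set" where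
  "algorithms p = insert \<infinity> (enat ` days p)"

definition cost :: "(nat \<Rightarrow> nat) \<Rightarrow> enat \<Rightarrow> nat \<Rightarrow> nat" where
  "cost p a T = (if enat T < a then T else buy_cost p (the_enat a))"

definition OPT :: "(nat \<Rightarrow> nat) \<Rightarrow> nat \<Rightarrow> nat" where
  "OPT p T = Min ({T} \<union> {buy_cost p i |i. i \<in> days p \<and> i \<le> T})"

definition competitive_with :: "real \<Rightarrow> real \<Rightarrow> (nat \<Rightarrow> nat) \<Rightarrow> enat \<Rightarrow> bool" where
  "competitive_with d0 \<gamma> p a \<longleftrightarrow>
     (\<forall>T\<ge>1. real (cost p a T) \<le> \<gamma> * real (OPT p T) + d0)"

text \<open>For fixed \<open>p\<close>, the cost of an algorithm that buys at all is bounded in \<open>T\<close>. If an additive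
  constant depending on \<open>p\<close> and the algorithm were allowed, every such algorithm would therefore be
  \<open>\<gamma>\<close>-competitive for every \<open>\<gamma> \<ge> 0\<close>, and neither a lower bound on the ratio nor a uniqueness claim
  could hold.\<close>

lemma competitive_with_additive_constant:
  assumes "0 \<le> \<gamma>"
  shows "\<exists>d0. competitive_with d0 \<gamma> p (enat r)"
proof -
  have "real (cost p (enat r) T) \<le> \<gamma> * real (OPT p T) + real (r + buy_cost p r)" for T
  proof -
    have "real (cost p (enat r) T) \<le> real (r + buy_cost p r)"
      by (simp add: cost_def)
    moreover have "0 \<le> \<gamma> * real (OPT p T)"
      using assms by simp
    ultimately show ?thesis by linarith
  qed
  then show ?thesis
    unfolding competitive_with_def by blast
qed

text \<open>Hence competitiveness for a given price sequence is understood with additive constant \<open>0\<close>.\<close>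

definition competitive :: "real \<Rightarrow> (nat \<Rightarrow> nat) \<Rightarrow> enat \<Rightarrow> bool" where
  "competitive \<gamma> p a \<longleftrightarrow> competitive_with 0 \<gamma> p a"

definition good_day :: "(nat \<Rightarrow> nat) \<Rightarrow> nat \<Rightarrow> bool" where
  "good_day p i \<longleftrightarrow> i = M_star p + 1 \<and> free_day p i \<or> i = M_star p \<and> bargain_day p i"

definition c_OPT :: "(nat \<Rightarrow> nat) \<Rightarrow> real" where
  "c_OPT p = Min ({real (buy_cost p r) / real r |r. r \<in> days p \<and> r \<le> M_star p}
                  \<union> {real (Q p (M_star p)) / real (M_star p)})"

definition candidate_ratios :: "(nat \<Rightarrow> nat) \<Rightarrow> real set" where
  "candidate_ratios p =
     {real (buy_cost p r) / real (OPT p r) |r. r \<in> days p \<and> r \<le> M_star p}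
     \<union> {real (buy_cost p r) / real (M_star p) |r.
          r \<in> days p \<and> M_star p \<le> r \<and> buy_cost p r = Q p (M_star p)}"

definition attains_min :: "(nat \<Rightarrow> nat) \<Rightarrow> nat \<Rightarrow> bool" where
  "attains_min p r \<longleftrightarrow> r \<in> days p \<and>
     (r \<le> M_star p \<and> real (buy_cost p r) / real (OPT p r) = Min (candidate_ratios p)
      \<or> M_star p \<le> r \<and> buy_cost p r = Q p (M_star p)
         \<and> real (buy_cost p r) / real (M_star p) = Min (candidate_ratios p))"

end

theory Submission
  imports Defs
begin

text \<open>Before day \<open>M + 1\<close> every price is positive and every \<open>P\<^sub>i\<close> is at least \<open>M\<close>, while the minimum
  \<open>M\<close> is attained no later than day \<open>M + 1\<close>; therefore \<open>OPT\<^sub>T = min T M\<close>. The most harmful active time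
  for the algorithm buying on day \<open>r\<close> is \<open>T = r\<close>, so for \<open>\<gamma> \<ge> 1\<close> it is \<open>\<gamma>\<close>-competitive iff
  \<open>P\<^sub>r \<le> \<gamma> min r M\<close>, and both parts reduce to comparing these quotients.\<close>

lemma days_ge_1: "i \<in> days p \<Longrightarrow> 1 \<le> i"
  by (simp add: days_def)

lemma M_star_le_buy_cost: "i \<in> days p \<Longrightarrow> M_star p \<le> buy_cost p i"
  unfolding M_star_def by (rule cInf_lower) auto

lemma M_star_attained:
  obtains i where "i \<in> days p" and "buy_cost p i = M_star p"
proof -
  have "1 \<in> days p" by (simp add: days_def)
  then have "{buy_cost p i |i. i \<in> days p} \<noteq> {}" by blast
  from Inf_nat_def1[OF this] show thesis
    unfolding M_star_def[symmetric] using that by auto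
qed

text \<open>A first zero on day \<open>i\<close> would give \<open>buy_cost p i = i - 1\<close>,
  below the minimum. The induction is strong because \<open>i \<in> days p\<close> presupposes
  nonzero prices on all earlier days.\<close>

lemma price_nonzero_upto_M_star:
  assumes "1 \<le> i" and "i \<le> M_star p"
  shows "p i \<noteq> 0"
  using assms
proof (induction i rule: less_induct)
  case (less i)
  have "i \<in> days p"
    using less by (auto simp: days_def)
  from M_star_le_buy_cost[OF this] show ?case
    using less.prems by (auto simp: buy_cost_def)
qed

lemma days_upto_Suc_M_star: "1 \<le> i \<Longrightarrow> i \<le> M_star p + 1 \<Longrightarrow> i \<in> days p"
  using price_nonzero_upto_M_star[of _ p] by (auto simp: days_def)

lemma buy_cost_ge: "1 \<le> r \<Longrightarrow> r \<le> M_star p \<Longrightarrow> r \<le> buy_cost p r"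
  using price_nonzero_upto_M_star[of r p] by (simp add: buy_cost_def)

lemma OPT_eq: "OPT p T = min T (M_star p)"
proof -
  let ?S = "{T} \<union> {buy_cost p i |i. i \<in> days p \<and> i \<le> T}"
  have "?S = {T} \<union> buy_cost p ` (days p \<inter> {..T})" by auto
  then have fin: "finite ?S" by simp
  obtain i where i: "i \<in> days p" "buy_cost p i = M_star p"
    by (rule M_star_attained)
  \<comment> \<open>Renting before a cheapest day \<open>i\<close> already costs
    \<open>i - 1\<close>, so this day has been reached as soon as \<open>T\<close> exceeds
    \<open>M_star p\<close>.\<close>
  have "i \<le> M_star p + 1"
    using i days_ge_1[OF i(1)] by (auto simp: buy_cost_def)
  then have "min T (M_star p) \<in> ?S"
  proof (cases "T \<le> M_star p")
    case False
    with \<open>i \<le> M_star p + 1\<close> i have "M_star p \<in> {buy_cost p i |i. i \<in> days p \<and> i \<le> T}"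
      by (auto intro!: exI[of _ i])
    with False show ?thesis by (simp add: min_def)
  qed (simp add: min_def)
  moreover have "min T (M_star p) \<le> x" if "x \<in> ?S" for x
    using that M_star_le_buy_cost[of _ p] by (auto simp: min.coboundedI2)
  ultimately show ?thesis
    unfolding OPT_def using fin by (intro Min_eqI) auto
qed

section \<open>Competitiveness of a single algorithm\<close>

lemma not_competitive_infinity: "\<not> competitive \<gamma> p \<infinity>"
proof
  assume comp: "competitive \<gamma> p \<infinity>"
  obtain n :: nat where n: "\<bar>\<gamma>\<bar> * real (M_star p) < real n"
    using reals_Archimedean2 by blast
  \<comment> \<open>This \<open>T\<close> exceeds both \<open>n\<close> and \<open>M_star p\<close>,
    so the optimum is frozen at \<open>M_star p\<close>.\<close>
  define T where "T = n + M_star p + 1"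
  have "real T \<le> \<gamma> * real (M_star p)"
    using comp[unfolded competitive_def competitive_with_def, rule_format, of T]
    by (simp add: cost_def OPT_eq T_def min_def)
  also have "\<dots> \<le> \<bar>\<gamma>\<bar> * real (M_star p)"
    by (intro mult_right_mono) auto
  finally show False
    using n by (simp add: T_def)
qed

text \<open>This is the instance \<open>T = r\<close>. It is kept apart from the equivalence below
  because it holds for every real \<gamma>, as the lower bound on the ratio requires.\<close>

lemma competitive_imp_buy_cost_le:
  assumes "competitive \<gamma> p (enat r)" and "1 \<le> r"
  shows "real (buy_cost p r) \<le> \<gamma> * real (min r (M_star p))"
  using assms by (auto simp: competitive_def competitive_with_def cost_def OPT_eq)

lemma competitive_iff:
  assumes "1 \<le> \<gamma>" and "1 \<le> r"
  shows "competitive \<gamma> p (enat r) \<longleftrightarrow> real (buy_cost p r) \<le> \<gamma> * real (min r (M_star p))"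
proof
  assume le: "real (buy_cost p r) \<le> \<gamma> * real (min r (M_star p))"
  have "real (cost p (enat r) T) \<le> \<gamma> * real (min T (M_star p))" for T
  proof -
    consider "T < r" "T \<le> M_star p" | "T < r" "M_star p < T" | "r \<le> T"
      by linarith
    then show ?thesis
    proof cases
      case 1
      then show ?thesis
        using mult_right_mono[OF assms(1), of "real T"] by (simp add: cost_def min_def)
    next
      case 2
      \<comment> \<open>Still renting after \<open>M_star p\<close> costs at most the
        \<open>r - 1\<close> rental days contained in \<open>buy_cost p r\<close>, and the optimum
        is \<open>M_star p\<close> at both \<open>T\<close> and \<open>r\<close>.\<close>
      then have "T \<le> buy_cost p r" by (simp add: buy_cost_def)
      then have "real T \<le> \<gamma> * real (min r (M_star p))" using le by linarith
      with 2 show ?thesis by (simp add: cost_def min_def)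
    next
      case 3
      then have "min r (M_star p) \<le> min T (M_star p)" by auto
      then have "\<gamma> * real (min r (M_star p)) \<le> \<gamma> * real (min T (M_star p))"
        using assms(1) by (intro mult_left_mono) auto
      with 3 le show ?thesis by (simp add: cost_def)
    qed
  qed
  then show "competitive \<gamma> p (enat r)"
    by (simp add: competitive_def competitive_with_def OPT_eq)
qed (use competitive_imp_buy_cost_le assms(2) in blast)

section \<open>Free days and bargain days\<close>

text \<open>With \<gamma> = 1 the criterion forces \<open>buy_cost p r = M_star p\<close> and
  \<open>p r \<le> 1\<close>; price 1 then means \<open>r = M_star p\<close>, price 0 means
  \<open>r = M_star p + 1\<close>.\<close>

lemma competitive_1_iff_good_day:
  assumes "r \<in> days p"
  shows "competitive 1 p (enat r) \<longleftrightarrow> good_day p r"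
proof -
  have "competitive 1 p (enat r) \<longleftrightarrow> buy_cost p r \<le> min r (M_star p)"
    using competitive_iff[of 1 r p] days_ge_1[OF assms] by (simp del: of_nat_min)
  also have "\<dots> \<longleftrightarrow> good_day p r"
    using M_star_le_buy_cost[OF assms] days_ge_1[OF assms] assms
    by (auto simp: good_day_def buy_cost_def free_day_def bargain_day_def)
  finally show ?thesis .
qed

text \<open>A bargain day \<open>i\<close> has \<open>buy_cost p i = i\<close>, so none can precede
  \<open>M_star p\<close>.\<close>

lemma first_bargain_day_M_star:
  "bargain_day p (M_star p) \<Longrightarrow> first_bargain_day p (M_star p)"
  using M_star_le_buy_cost[of _ p]
  by (fastforce simp: first_bargain_day_def bargain_day_def buy_cost_def days_def)

lemma first_free_day_Suc_M_star:
  "free_day p (M_star p + 1) \<Longrightarrow> first_free_day p (M_star p + 1)"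
  using price_nonzero_upto_M_star[of _ p]
  by (auto simp: first_free_day_def free_day_def days_def)

lemma good_day_Least:
  assumes "free_day p (M_star p + 1) \<or> bargain_day p (M_star p)"
  shows "(LEAST i. good_day p i) = (if bargain_day p (M_star p) then M_star p else M_star p + 1)"
  using assms by (intro Least_equality) (auto simp: good_day_def)

text \<open>Up to day \<open>M_star p\<close> prices are positive, and price 1 on day
  \<open>i\<close> gives \<open>buy_cost p i = i\<close>, which is below the minimum unless
  \<open>i = M_star p\<close>. So excluding a bargain on that one day excludes it on all earlier
  days.\<close>

lemma no_good_day_iff:
  "\<not> (free_day p (M_star p + 1) \<or> bargain_day p (M_star p)) \<longleftrightarrow>
     (\<forall>i. 1 \<le> i \<and> i \<le> M_star p \<longrightarrow> 1 < p i) \<and> 1 \<le> p (M_star p + 1)"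
  (is "?L \<longleftrightarrow> ?R")
proof
  assume L: ?L
  have "1 < p i" if i: "1 \<le> i" "i \<le> M_star p" for i
  proof -
    have days: "i \<in> days p" using i by (intro days_upto_Suc_M_star) auto
    have "p i \<noteq> 1"
    proof
      assume "p i = 1"
      then have "i = M_star p"
        using M_star_le_buy_cost[OF days] i by (simp add: buy_cost_def)
      with L days \<open>p i = 1\<close> show False by (auto simp: bargain_day_def)
    qed
    with price_nonzero_upto_M_star[OF i] show ?thesis by linarith
  qed
  moreover have "1 \<le> p (M_star p + 1)"
    using L days_upto_Suc_M_star[of "M_star p + 1" p] by (auto simp: free_day_def)
  ultimately show ?R by blast
next
  assume ?R
  then show ?L
    using days_ge_1[of "M_star p" p] by (auto simp: free_day_def bargain_day_def)
qed

text \<open>Minimum 0 is possible only if day 1 is free, and that is then day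
  \<open>M_star p + 1\<close>. This keeps the denominators of the ratios nonzero.\<close>

lemma M_star_pos:
  assumes "\<not> free_day p (M_star p + 1)"
  shows "1 \<le> M_star p"
proof (rule ccontr)
  assume "\<not> 1 \<le> M_star p"
  then have "M_star p = 0" by simp
  moreover obtain i where "i \<in> days p" "buy_cost p i = M_star p"
    by (rule M_star_attained)
  ultimately show False
    using assms days_ge_1[of i p] by (auto simp: buy_cost_def free_day_def le_Suc_eq)
qed

section \<open>The optimal ratio when there is no good day\<close>

lemma Q_le_buy_cost: "i \<in> days p \<Longrightarrow> t \<le> i \<Longrightarrow> Q p t \<le> buy_cost p i"
  unfolding Q_def by (rule cInf_lower) auto

lemma Q_attained:
  assumes "t \<in> days p"
  obtains i where "i \<in> days p" and "t \<le> i" and "buy_cost p i = Q p t"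
proof -
  have "{buy_cost p i |i. i \<in> days p \<and> t \<le> i} \<noteq> {}" using assms by blast
  from Inf_nat_def1[OF this] show thesis
    unfolding Q_def[symmetric] using that by auto
qed

context
  fixes p :: "nat \<Rightarrow> nat" and M :: nat
  assumes M_eq: "M = M_star p" and M_pos: "1 \<le> M"
begin

text \<open>Up to day \<open>M\<close> the optimum at \<open>r\<close> is \<open>r\<close> itself,
  and the late candidates all share one value, present because \<open>Q p M\<close> is attained.
  Hence the two minima in the theorem agree.\<close>

lemma candidate_ratios_eq:
  "candidate_ratios p =
     {real (buy_cost p r) / real r |r. r \<in> days p \<and> r \<le> M} \<union> {real (Q p M) / real M}"
proof -
  have "M \<in> days p"
    using M_pos by (intro days_upto_Suc_M_star) (auto simp: M_eq)
  then obtain i where i: "i \<in> days p" "M \<le> i" "buy_cost p i = Q p M"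
    by (rule Q_attained)
  have "{real (buy_cost p r) / real M |r. r \<in> days p \<and> M \<le> r \<and> buy_cost p r = Q p M} =
      {real (Q p M) / real M}"
    using i by (auto intro!: exI[of _ i])
  moreover have "{real (buy_cost p r) / real (OPT p r) |r. r \<in> days p \<and> r \<le> M} =
      {real (buy_cost p r) / real r |r. r \<in> days p \<and> r \<le> M}"
    by (force simp: OPT_eq M_eq min_def)
  ultimately show ?thesis
    unfolding candidate_ratios_def M_eq by simp
qed

lemma c_OPT_eq_Min_candidate_ratios: "c_OPT p = Min (candidate_ratios p)"
  by (simp add: candidate_ratios_eq c_OPT_def M_eq)

lemma finite_candidate_ratios: "finite (candidate_ratios p)"
proof -
  have "{real (buy_cost p r) / real r |r. r \<in> days p \<and> r \<le> M} =
      (\<lambda>r. real (buy_cost p r) / real r) ` (days p \<inter> {..M})"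
    by auto
  then show ?thesis by (simp add: candidate_ratios_eq)
qed

lemma c_OPT_le_candidate: "x \<in> candidate_ratios p \<Longrightarrow> c_OPT p \<le> x"
  unfolding c_OPT_eq_Min_candidate_ratios by (intro Min_le finite_candidate_ratios)

lemma c_OPT_le_early: "r \<in> days p \<Longrightarrow> r \<le> M \<Longrightarrow> c_OPT p \<le> real (buy_cost p r) / real r"
  by (rule c_OPT_le_candidate) (auto simp: candidate_ratios_eq)

lemma c_OPT_le_late: "c_OPT p \<le> real (Q p M) / real M"
  by (rule c_OPT_le_candidate) (simp add: candidate_ratios_eq)

text \<open>Makes \<open>competitive_iff\<close> applicable with \<gamma> =
  \<open>c_OPT p\<close>.\<close>

lemma c_OPT_ge_1: "1 \<le> c_OPT p"
proof -
  have "M \<in> days p"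
    using M_pos by (intro days_upto_Suc_M_star) (auto simp: M_eq)
  then obtain i where "i \<in> days p" "M \<le> i" "buy_cost p i = Q p M"
    by (rule Q_attained)
  then have "M \<le> Q p M"
    using M_star_le_buy_cost[of i p] by (simp add: M_eq)
  then have "\<forall>x \<in> candidate_ratios p. 1 \<le> x"
    using M_pos by (auto simp: candidate_ratios_eq M_eq days_def intro!: buy_cost_ge)
  moreover have "candidate_ratios p \<noteq> {}"
    by (simp add: candidate_ratios_eq)
  ultimately show ?thesis
    by (simp add: c_OPT_eq_Min_candidate_ratios finite_candidate_ratios)
qed

text \<open>The right-hand side is the smallest ratio that the active time \<open>T = r\<close>
  permits. Days after \<open>M\<close> that miss \<open>Q p M\<close> are covered too, since they
  only cost more.\<close>

lemma c_OPT_le_ratio: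
  assumes "r \<in> days p"
  shows "c_OPT p \<le> real (buy_cost p r) / real (min r M)"
proof (cases "r \<le> M")
  case True
  then show ?thesis using c_OPT_le_early[OF assms True] by (simp add: min_def)
next
  case False
  then have "real (Q p M) / real M \<le> real (buy_cost p r) / real M"
    using Q_le_buy_cost[OF assms, of M] by (intro divide_right_mono) auto
  with c_OPT_le_late False show ?thesis by (simp add: min_def)
qed

lemma attains_min_iff:
  assumes "r \<in> days p"
  shows "attains_min p r \<longleftrightarrow> real (buy_cost p r) / real (min r M) = c_OPT p"
proof (cases "r \<le> M")
  case True
  then show ?thesis
    using assms
    by (auto simp: attains_min_def OPT_eq c_OPT_eq_Min_candidate_ratios M_eq min_def)
next
  case False
  \<comment> \<open>A late day with the optimal ratio cannot cost more than \<open>Q p M\<close>, so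
    the extra condition in \<open>attains_min\<close> is automatic.\<close>
  have "buy_cost p r = Q p M" if "real (buy_cost p r) / real M = c_OPT p"
  proof -
    have "real (buy_cost p r) / real M \<le> real (Q p M) / real M"
      using that c_OPT_le_late by simp
    then have "buy_cost p r \<le> Q p M"
      using M_pos by (simp add: divide_le_cancel)
    with Q_le_buy_cost[OF assms, of M] False show ?thesis by simp
  qed
  with False assms show ?thesis
    by (auto simp: attains_min_def c_OPT_eq_Min_candidate_ratios M_eq min_def)
qed

lemma competitive_imp_c_OPT_le:
  assumes "a \<in> algorithms p" and "competitive \<gamma> p a"
  shows "c_OPT p \<le> \<gamma>"
proof -
  obtain r where r: "a = enat r" "r \<in> days p"
    using assms not_competitive_infinity by (auto simp: algorithms_def)
  have "real (buy_cost p r) / real (min r M) \<le> \<gamma>"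
    using competitive_imp_buy_cost_le[of \<gamma> p r] assms(2) r(1) days_ge_1[OF r(2)] M_pos
    by (simp add: M_eq divide_le_eq del: of_nat_min)
  with c_OPT_le_ratio[OF r(2)] show ?thesis by simp
qed

lemma competitive_c_OPT_iff:
  assumes "a \<in> algorithms p"
  shows "competitive (c_OPT p) p a \<longleftrightarrow> (\<exists>r. a = enat r \<and> attains_min p r)"
proof -
  have "competitive (c_OPT p) p (enat r) \<longleftrightarrow> attains_min p r" if r: "r \<in> days p" for r
  proof -
    have "competitive (c_OPT p) p (enat r) \<longleftrightarrow> real (buy_cost p r) / real (min r M) \<le> c_OPT p"
      using competitive_iff[OF c_OPT_ge_1, of r] days_ge_1[OF r] M_pos
      by (simp add: M_eq divide_le_eq del: of_nat_min)
    \<comment> \<open>The ratio of day \<open>r\<close> is never below \<open>c_OPT p\<close>, so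
      the inequality is an equality.\<close>
    then show ?thesis
      using c_OPT_le_ratio[OF r] attains_min_iff[OF r] by auto
  qed
  then show ?thesis
    using assms not_competitive_infinity by (auto simp: algorithms_def)
qed

end

theorem theorem3:
  fixes B :: nat and p :: "nat \<Rightarrow> nat"
  assumes "2 \<le> B" and "price_sequence B p"
  defines "M \<equiv> M_star p"
  defines "d \<equiv> (LEAST i. good_day p i)"
  shows
    "(free_day p (M + 1) \<or> bargain_day p M \<longrightarrow>
        d = (if bargain_day p M then M else M + 1) \<and>
        enat d \<in> algorithms p \<and> competitive 1 p (enat d) \<and>
        (\<forall>a\<in>algorithms p. a \<noteq> enat d \<longrightarrow>
           (competitive 1 p a \<longleftrightarrow>
              first_bargain_day p M \<and> first_free_day p (M + 1) \<and> a = enat (M + 1)))) \<and>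
     (\<not> (free_day p (M + 1) \<or> bargain_day p M) \<longleftrightarrow>
        (\<forall>i. 1 \<le> i \<and> i \<le> M \<longrightarrow> i \<in> days p \<and> 1 < p i \<and> p i \<le> B) \<and>
        M + 1 \<in> days p \<and> 1 \<le> p (M + 1)) \<and>
     (\<not> (free_day p (M + 1) \<or> bargain_day p M) \<longrightarrow>
        (\<forall>a\<in>algorithms p. \<forall>\<gamma>. competitive \<gamma> p a \<longrightarrow> c_OPT p \<le> \<gamma>) \<and>
        (\<forall>a\<in>algorithms p. competitive (c_OPT p) p a \<longleftrightarrow>
           (\<exists>r. a = enat r \<and> attains_min p r)))"
proof (intro conjI)
  show "free_day p (M + 1) \<or> bargain_day p M \<longrightarrow>
        d = (if bargain_day p M then M else M + 1) \<and>
        enat d \<in> algorithms p \<and> competitive 1 p (enat d) \<and>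
        (\<forall>a\<in>algorithms p. a \<noteq> enat d \<longrightarrow>
           (competitive 1 p a \<longleftrightarrow>
              first_bargain_day p M \<and> first_free_day p (M + 1) \<and> a = enat (M + 1)))"
    (is "?A \<longrightarrow> _")
  proof (intro impI conjI ballI)
    assume A: ?A
    show d: "d = (if bargain_day p M then M else M + 1)"
      unfolding d_def M_def using A by (intro good_day_Least) (simp add: M_def)
    have good: "good_day p d" and d_days: "d \<in> days p"
      using A by (auto simp: d good_day_def M_def free_day_def bargain_day_def)
    show "enat d \<in> algorithms p"
      using d_days by (simp add: algorithms_def)
    show "competitive 1 p (enat d)"
      using good competitive_1_iff_good_day[OF d_days] by simp
    fix a assume a: "a \<in> algorithms p" "a \<noteq> enat d"
    show "competitive 1 p a \<longleftrightarrow>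
        first_bargain_day p M \<and> first_free_day p (M + 1) \<and> a = enat (M + 1)" (is "?C \<longleftrightarrow> ?D")
    proof
      assume C: ?C
      then obtain r where r: "a = enat r" "r \<in> days p"
        using a not_competitive_infinity by (auto simp: algorithms_def)
      then have "good_day p r" "r \<noteq> d"
        using C a competitive_1_iff_good_day by auto
      \<comment> \<open>Only \<open>M\<close> and \<open>M + 1\<close> can be good; two distinct
        good days use up both, and \<open>d\<close> is the smaller one.\<close>
      then have "bargain_day p M" "free_day p (M + 1)" "r = M + 1"
        by (auto simp: d good_day_def M_def split: if_splits)
      then show ?D
        using r first_bargain_day_M_star first_free_day_Suc_M_star by (simp add: M_def)
    next
      assume D: ?D
      then have "good_day p (M + 1)" "M + 1 \<in> days p"
        by (auto simp: first_free_day_def good_day_def M_def free_day_def)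
      with D show ?C
        using competitive_1_iff_good_day by simp
    qed
  qed
  show "\<not> (free_day p (M + 1) \<or> bargain_day p M) \<longleftrightarrow>
        (\<forall>i. 1 \<le> i \<and> i \<le> M \<longrightarrow> i \<in> days p \<and> 1 < p i \<and> p i \<le> B) \<and>
        M + 1 \<in> days p \<and> 1 \<le> p (M + 1)"
  proof -
    have "i \<in> days p" "p i \<le> B" if "1 \<le> i" "i \<le> M + 1" for i
      using that days_upto_Suc_M_star[of i p] assms(2) by (auto simp: M_def price_sequence_def)
    then show ?thesis
      using no_good_day_iff[of p] unfolding M_def[symmetric] by auto
  qed
  show "\<not> (free_day p (M + 1) \<or> bargain_day p M) \<longrightarrow>
        (\<forall>a\<in>algorithms p. \<forall>\<gamma>. competitive \<gamma> p a \<longrightarrow> c_OPT p \<le> \<gamma>) \<and>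
        (\<forall>a\<in>algorithms p. competitive (c_OPT p) p a \<longleftrightarrow>
           (\<exists>r. a = enat r \<and> attains_min p r))"
  proof
    assume "\<not> (free_day p (M + 1) \<or> bargain_day p M)"
    then have "1 \<le> M"
      using M_star_pos by (simp add: M_def)
    then show "(\<forall>a\<in>algorithms p. \<forall>\<gamma>. competitive \<gamma> p a \<longrightarrow> c_OPT p \<le> \<gamma>) \<and>
        (\<forall>a\<in>algorithms p. competitive (c_OPT p) p a \<longleftrightarrow>
           (\<exists>r. a = enat r \<and> attains_min p r))"
      using competitive_imp_c_OPT_le[OF M_def[THEN meta_eq_to_obj_eq]]
        competitive_c_OPT_iff[OF M_def[THEN meta_eq_to_obj_eq]] by blast
  qed
qed

end
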